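(* For every computable Polish space $X$ and every $n\in\mathbb N$, the problems $\mathsf{BCT}_{0,X}^{(n)}$ and $\mathsf{BCT}_{2,X}^{(n)}$ are strongly parallelizable and strongly idempotent.
   Context: Represented spaces and Weihrauch reducibility. The symbol $\subseteq$ in front of a domain means "possibly partial". A represented space $(X,\delta_X)$ is a set $X$ with a surjective partial map $\delta_X:\subseteq\mathbb N^{\mathbb N}\to X$. A multi-valued function $f:\subseteq X\rightrightarrows Y$ assigns to each $x\in\mathrm{dom}(f)$ a nonempty set $f(x)\subseteq Y$. A realizer $F\vdash f$ is a partial function $F:\subseteq\mathbb N^{\mathbb N}\to\mathbb N^{\mathbb N}$ with $\delta_YF(p)\in f(\delta_X(p))$ for all $p\in\mathrm{dom}(f\delta_X)$. $f\le_{\mathrm{sW}}g$: there are computable $K,H:\subseteq\mathbb N^{\mathbb N}\to\mathbb N^{\mathbb N}$ with $HGK\vdash f$ for all $G\vdash g$; $\equiv_{\mathrm{sW}}$ is reducibility in both directions. Products $X\times Y$ and sequence spaces $X^{\mathbb N}$ carry the canonical representations; with $\langle p_0,p_1,\dots\rangle(\langle i,j\rangle):=p_i(j)$ one has $\delta_X^{\mathbb N}\langle p_0,p_1,\dots\rangle:=(\delta_X(p_i))_i$. The product is $(f\times g)(x,z):=f(x)\times g(z)$; the parallelization is $\widehat f:\subseteq X^{\mathbb N}\rightrightarrows Y^{\mathbb N}$, $\widehat f((x_i)_i):=\prod_{i\in\mathbb N}f(x_i)$. $f$ is strongly parallelizable if $f\equiv_{\mathrm{sW}}\widehat f$, and strongly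 idempotent if $f\equiv_{\mathrm{sW}}f\times f$. Jump. $\lim:\subseteq\mathbb N^{\mathbb N}\to\mathbb N^{\mathbb N}$, $\langle p_0,p_1,\dots\rangle\mapsto\lim_np_n$ (product topology). The jump $f'$ of $f:\subseteq(X,\delta_X)\rightrightarrows(Y,\delta_Y)$ is the same multi-valued function with input representation replaced by $\delta_X\circ\lim$; $f^{(n)}$ is the $n$-fold jump, $f^{(0)}=f$. A computable Polish space $(X,d,\alpha)$ is a complete metric space with a dense sequence $\alpha:\mathbb N\to X$ such that $d\circ(\alpha\times\alpha):\mathbb N^2\to\mathbb R$ is computable. Its Cauchy representation is $\delta_X(p)=\lim_n\alpha(p(n))$, for those $p$ with $d(\alpha p(n),\alpha p(k))<2^{-k}$ for all $k$ and $n\ge k$. $X\sqcup\{\infty\}$ is $X$ with an additional isolated point $\infty$ at distance $1$ from all other points. $\mathcal A_-(X)$ is the set of closed subsets of $X$ with representation $\psi_-(p):=X\setminus\bigcup_iB_{p(i)}$, where $B_{\langle n,k\rangle}:=B(\alpha(n),\overline k)$ and $\overline k$ is the $k$-th rational in a standard enumeration. $\mathcal A_+(X)$ is the set of closed subsets of $X$ with representation $\psi_+(p)=A$ iff $\delta^{\mathbb N}_{X\sqcup\{\infty\}}(p)=(x_n)_n$ and $\overline{\{x_n:n\in\mathbb N\}}\cap X=A$. $\mathsf{BCT}_{0,X}:\subseteq\mathcal A_-(X)^{\mathbb N}\rightrightarrows X$ and $\mathsf{BCT}_{2,X}:\subseteq\mathcal A_+(X)^{\mathbb N}\rightrightarrows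 X$ both map $(A_i)_i$ to $X\setminus\bigcup_iA_i$, with domain all $(A_i)_i$ such that every $A_i$ has empty interior. *)

theory Defs
  imports "HOL-Analysis.Analysis"
begin

section \<open>Computable partial functions on Baire space\<close>

type_synonym baire = "nat \<Rightarrow> nat"

text \<open>
  Kleene's schemes for functions that are partial recursive in an oracle.  Arities are not
  enforced: \<open>Succ\<close>, \<open>Oracle\<close>, \<open>Prec\<close> and \<open>Proj\<close> diverge on argument lists that are too short.
\<close>

datatype recfn =
    Zero
  | Succ
  | Oracle
  | Proj nat
  | Comp recfn "recfn list"
  | Prec recfn recfn
  | Mini recfn

fun run :: "baire \<Rightarrow> recfn \<Rightarrow> nat list \<Rightarrow> nat option" where
  "run p Zero xs = Some 0"
| "run p Succ xs = (case xs of [] \<Rightarrow> None | x # _ \<Rightarrow> Some (Suc x))"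
| "run p Oracle xs = (case xs of [] \<Rightarrow> None | x # _ \<Rightarrow> Some (p x))"
| "run p (Proj i) xs = (if i < length xs then Some (xs ! i) else None)"
| "run p (Comp f gs) xs =
     (let ys = map (\<lambda>g. run p g xs) gs
      in if None \<in> set ys then None else run p f (map the ys))"
| "run p (Prec f g) xs =
     (case xs of [] \<Rightarrow> None
      | m # zs \<Rightarrow>
          rec_nat (run p f zs) (\<lambda>k r. Option.bind r (\<lambda>v. run p g (v # k # zs))) m)"
| "run p (Mini f) xs =
     (if \<exists>m. run p f (m # xs) = Some 0 \<and> (\<forall>k<m. run p f (k # xs) \<noteq> None)
      then Some (LEAST m. run p f (m # xs) = Some 0) else None)"

text \<open>
  A partial function is computable if one oracle program computes it on its whole domain; as
  usual in the theory of Weihrauch degrees, nothing is required outside the domain.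
\<close>

definition computable :: "(baire \<rightharpoonup> baire) \<Rightarrow> bool" where
  "computable F \<longleftrightarrow> (\<exists>c. \<forall>p q. F p = Some q \<longrightarrow> (\<forall>n. run p c [n] = Some (q n)))"


section \<open>Represented spaces\<close>

text \<open>The underlying set of the space represented by \<open>\<delta>\<close> is \<open>ran \<delta>\<close>.\<close>

type_synonym 'a rep = "baire \<rightharpoonup> 'a"

definition row :: "baire \<Rightarrow> nat \<Rightarrow> baire" where
  "row p i = (\<lambda>j. p (prod_encode (i, j)))"

definition rep_nat :: "nat rep" where
  "rep_nat p = Some (p 0)"

definition rep_prod :: "'a rep \<Rightarrow> 'b rep \<Rightarrow> ('a \<times> 'b) rep" where
  "rep_prod \<delta> \<epsilon> p =
     (case (\<delta> (\<lambda>n. p (2 * n)), \<epsilon> (\<lambda>n. p (2 * n + 1))) of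
        (Some x, Some y) \<Rightarrow> Some (x, y)
      | _ \<Rightarrow> None)"

definition rep_seq :: "'a rep \<Rightarrow> (nat \<Rightarrow> 'a) rep" where
  "rep_seq \<delta> p =
     (if \<forall>i. \<delta> (row p i) \<noteq> None then Some (\<lambda>i. the (\<delta> (row p i))) else None)"


section \<open>Problems and strong Weihrauch reducibility\<close>

text \<open>
  A problem is a partial multi-valued function together with the representations of its source
  and its target.  The domain of the multi-valued function consists of the points whose set of
  values is nonempty.
\<close>

record ('a, 'b) problem =
  in_rep :: "'a rep"
  out_rep :: "'b rep"
  vals :: "'a \<Rightarrow> 'b set"

definition realizes :: "(baire \<rightharpoonup> baire) \<Rightarrow> ('a, 'b) problem \<Rightarrow> bool" (infix \<open>\<turnstile>r\<close> 50) where
  "F \<turnstile>r f \<longleftrightarrow>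
     (\<forall>p x. in_rep f p = Some x \<and> vals f x \<noteq> {} \<longrightarrow>
        (\<exists>y. (out_rep f \<circ>\<^sub>m F) p = Some y \<and> y \<in> vals f x))"

definition computable_problem :: "('a, 'b) problem \<Rightarrow> bool" where
  "computable_problem f \<longleftrightarrow> (\<exists>F. computable F \<and> F \<turnstile>r f)"

definition sW_le :: "('a, 'b) problem \<Rightarrow> ('c, 'd) problem \<Rightarrow> bool" (infix \<open>\<le>sW\<close> 50) where
  "f \<le>sW g \<longleftrightarrow>
     (\<exists>K H. computable K \<and> computable H \<and> (\<forall>G. G \<turnstile>r g \<longrightarrow> (H \<circ>\<^sub>m G \<circ>\<^sub>m K) \<turnstile>r f))"

definition sW_equiv :: "('a, 'b) problem \<Rightarrow> ('c, 'd) problem \<Rightarrow> bool" (infix \<open>\<equiv>sW\<close> 50) where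
  "f \<equiv>sW g \<longleftrightarrow> f \<le>sW g \<and> g \<le>sW f"

definition prod_problem ::
  "('a, 'b) problem \<Rightarrow> ('c, 'd) problem \<Rightarrow> ('a \<times> 'c, 'b \<times> 'd) problem" where
  "prod_problem f g =
     \<lparr> in_rep = rep_prod (in_rep f) (in_rep g),
       out_rep = rep_prod (out_rep f) (out_rep g),
       vals = (\<lambda>(x, z). vals f x \<times> vals g z) \<rparr>"

definition parallelization :: "('a, 'b) problem \<Rightarrow> (nat \<Rightarrow> 'a, nat \<Rightarrow> 'b) problem" where
  "parallelization f =
     \<lparr> in_rep = rep_seq (in_rep f),
       out_rep = rep_seq (out_rep f),
       vals = (\<lambda>x. {y. \<forall>i. y i \<in> vals f (x i)}) \<rparr>"

definition strongly_parallelizable :: "('a, 'b) problem \<Rightarrow> bool" where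
  "strongly_parallelizable f \<longleftrightarrow> f \<equiv>sW parallelization f"

definition strongly_idempotent :: "('a, 'b) problem \<Rightarrow> bool" where
  "strongly_idempotent f \<longleftrightarrow> f \<equiv>sW prod_problem f f"

text \<open>Convergence in \<^typ>\<open>baire\<close> is convergence in the product topology.\<close>

definition baire_lim :: "baire \<rightharpoonup> baire" where
  "baire_lim p = (if convergent (row p) then Some (THE q. row p \<longlonglongrightarrow> q) else None)"

lemma baire_lim_eq:
  "baire_lim p = Some q \<longleftrightarrow> (\<forall>j. \<forall>\<^sub>F n in sequentially. row p n j = q j)"
proof -
  have coord: "row p \<longlonglongrightarrow> q \<longleftrightarrow> (\<forall>j. \<forall>\<^sub>F n in sequentially. row p n j = q j)" for q
    using limitin_componentwise[of "\<lambda>_::nat. euclidean :: nat topology" UNIV "row p" q sequentially]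
    by (simp add: euclidean_product_topology nhds_discrete filterlim_principal)
  have uniq: "q = q'" if "row p \<longlonglongrightarrow> q" "row p \<longlonglongrightarrow> q'" for q q'
  proof
    fix j
    have "\<forall>\<^sub>F n in sequentially. row p n j = q j \<and> row p n j = q' j"
      using that by (simp add: coord eventually_conj)
    then show "q j = q' j"
      by (auto dest: eventually_happens)
  qed
  have "(THE q. row p \<longlonglongrightarrow> q) = q" if "row p \<longlonglongrightarrow> q" for q
    using that by (intro the_equality) (auto dest: uniq[OF that])
  then have "baire_lim p = Some q \<longleftrightarrow> row p \<longlonglongrightarrow> q"
    unfolding baire_lim_def convergent_def by auto
  with coord show ?thesis by simp
qed

definition jump :: "('a, 'b) problem \<Rightarrow> ('a, 'b) problem" where
  "jump f = f\<lparr> in_rep := in_rep f \<circ>\<^sub>m baire_lim \<rparr>"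


section \<open>Computable Polish spaces\<close>

definition cauchy_lim :: "'a set \<Rightarrow> ('a \<Rightarrow> 'a \<Rightarrow> real) \<Rightarrow> (nat \<Rightarrow> 'a) \<Rightarrow> 'a \<Rightarrow> bool" where
  "cauchy_lim M d s x \<longleftrightarrow> x \<in> M \<and> (\<lambda>n. d (s n) x) \<longlonglongrightarrow> 0"

definition cauchy_rep :: "'a set \<Rightarrow> ('a \<Rightarrow> 'a \<Rightarrow> real) \<Rightarrow> (nat \<Rightarrow> 'a) \<Rightarrow> 'a rep" where
  "cauchy_rep M d \<alpha> p =
     (if (\<forall>k. \<forall>n\<ge>k. d (\<alpha> (p n)) (\<alpha> (p k)) < (1 / 2) ^ k) \<and> (\<exists>x. cauchy_lim M d (\<alpha> \<circ> p) x)
      then Some (THE x. cauchy_lim M d (\<alpha> \<circ> p) x) else None)"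

definition rat_enum :: "nat \<Rightarrow> real" where
  "rat_enum k = of_rat (nat_to_rat_surj k)"

definition rep_real :: "real rep" where
  "rep_real = cauchy_rep UNIV dist rat_enum"

locale computable_polish_space = Metric_space M d
  for M :: "'a set" and d :: "'a \<Rightarrow> 'a \<Rightarrow> real" +
  fixes \<alpha> :: "nat \<Rightarrow> 'a"
  assumes complete: mcomplete
    and dense_in: "range \<alpha> \<subseteq> M"
    and dense: "mtopology closure_of (range \<alpha>) = M"
    and computable_dist:
      "computable_problem
         \<lparr> in_rep = rep_prod rep_nat rep_nat,
           out_rep = rep_real,
           vals = (\<lambda>(i, j). {d (\<alpha> i) (\<alpha> j)}) \<rparr>"

lemma (in computable_polish_space) ran_cauchy_rep: "ran (cauchy_rep M d \<alpha>) = M"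
proof -
  have uniq: "x = y" if "cauchy_lim M d s x" "cauchy_lim M d s y" "\<And>n. s n \<in> M" for s x y
  proof -
    have x: "x \<in> M" and y: "y \<in> M"
      using that by (auto simp: cauchy_lim_def)
    have "(\<lambda>n. d (s n) x + d (s n) y) \<longlonglongrightarrow> 0 + 0"
      using that by (intro tendsto_add) (auto simp: cauchy_lim_def)
    moreover have "d x y \<le> d (s n) x + d (s n) y" for n
      using triangle[OF x that(3)[of n] y] commute[of x "s n"] by simp
    ultimately have "d x y \<le> 0"
      using LIMSEQ_le_const[of "\<lambda>n. d (s n) x + d (s n) y" 0 "d x y"] by auto
    then show ?thesis
      using x y nonneg[of x y] by (simp add: order_antisym)
  qed
  have inM: "\<alpha> i \<in> M" for i
    using dense_in by auto
  have val: "cauchy_rep M d \<alpha> p = Some x"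
    if "\<forall>k. \<forall>n\<ge>k. d (\<alpha> (p n)) (\<alpha> (p k)) < (1 / 2) ^ k" "cauchy_lim M d (\<alpha> \<circ> p) x" for p x
  proof -
    have "(THE x. cauchy_lim M d (\<alpha> \<circ> p) x) = x"
      using that(2) uniq inM by (intro the_equality) auto
    then show ?thesis
      using that by (auto simp: cauchy_rep_def)
  qed
  show ?thesis
  proof (intro equalityI subsetI)
    fix x assume "x \<in> ran (cauchy_rep M d \<alpha>)"
    then obtain p where p: "cauchy_rep M d \<alpha> p = Some x"
      by (auto simp: ran_def)
    then obtain y where "cauchy_lim M d (\<alpha> \<circ> p) y"
        "\<forall>k. \<forall>n\<ge>k. d (\<alpha> (p n)) (\<alpha> (p k)) < (1 / 2) ^ k"
      unfolding cauchy_rep_def by (auto split: if_splits)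
    with val p show "x \<in> M"
      by (auto simp: cauchy_lim_def)
  next
    fix x assume x: "x \<in> M"
    have "\<exists>i. d (\<alpha> i) x < (1 / 2) ^ (k + 1)" for k
    proof -
      have "x \<in> mtopology closure_of (range \<alpha>)"
        using x dense by simp
      then have "\<forall>r>0. \<exists>y\<in>range \<alpha>. y \<in> mball x r"
        unfolding metric_closure_of by blast
      then have "\<exists>y\<in>range \<alpha>. y \<in> mball x ((1 / 2) ^ (k + 1))"
        by (meson zero_less_power half_gt_zero zero_less_one)
      then show ?thesis
        by (auto simp: commute)
    qed
    then obtain p where p: "\<And>k. d (\<alpha> (p k)) x < (1 / 2) ^ (k + 1)"
      by metis
    have "d (\<alpha> (p n)) (\<alpha> (p k)) < (1 / 2) ^ k" if "k \<le> n" for n k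
    proof -
      have "d (\<alpha> (p n)) (\<alpha> (p k)) \<le> d (\<alpha> (p n)) x + d (\<alpha> (p k)) x"
        using triangle[OF inM x inM, of "p n" "p k"] commute[of x "\<alpha> (p k)"] by simp
      moreover have "(1 / 2 :: real) ^ n \<le> (1 / 2) ^ k"
        using that by (intro power_decreasing) auto
      ultimately show ?thesis
        using p[of n] p[of k] unfolding power_add power_one_right by linarith
    qed
    moreover have "cauchy_lim M d (\<alpha> \<circ> p) x"
    proof -
      have "(\<lambda>n. (1 / 2 :: real) ^ (n + 1)) \<longlonglongrightarrow> 0"
        using LIMSEQ_ignore_initial_segment[OF LIMSEQ_realpow_zero[of "1/2"], of 1] by simp
      then have "(\<lambda>n. d (\<alpha> (p n)) x) \<longlonglongrightarrow> 0"
        by (rule tendsto_sandwich[OF _ _ tendsto_const, rotated 2])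
          (intro always_eventually allI nonneg less_imp_le[OF p])+
      then show ?thesis
        using x by (simp add: cauchy_lim_def)
    qed
    ultimately have "cauchy_rep M d \<alpha> p = Some x"
      by (intro val) auto
    then show "x \<in> ran (cauchy_rep M d \<alpha>)"
      by (auto simp: ran_def)
  qed
qed

text \<open>
  The space with an additional isolated point \<open>\<infinity> = None\<close>.  If the original space has diameter
  greater than \<open>2\<close>, then \<open>d_inf d\<close> violates the triangle inequality.  This is harmless, since the
  Cauchy representation depends only on which distances are smaller than \<open>\<epsilon>\<close> for
  \<open>\<epsilon> \<le> 1\<close>: it does not change if \<open>d\<close> is replaced by \<open>min d 1\<close>.
\<close>

fun d_inf :: "('a \<Rightarrow> 'a \<Rightarrow> real) \<Rightarrow> 'a option \<Rightarrow> 'a option \<Rightarrow> real" where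
  "d_inf d (Some x) (Some y) = d x y"
| "d_inf d None None = 0"
| "d_inf d _ _ = 1"

fun \<alpha>_inf :: "(nat \<Rightarrow> 'a) \<Rightarrow> nat \<Rightarrow> 'a option" where
  "\<alpha>_inf \<alpha> 0 = None"
| "\<alpha>_inf \<alpha> (Suc n) = Some (\<alpha> n)"

definition rep_inf :: "'a set \<Rightarrow> ('a \<Rightarrow> 'a \<Rightarrow> real) \<Rightarrow> (nat \<Rightarrow> 'a) \<Rightarrow> 'a option rep" where
  "rep_inf M d \<alpha> = cauchy_rep (insert None (Some ` M)) (d_inf d) (\<alpha>_inf \<alpha>)"


section \<open>Closed sets and the Baire category problems\<close>

definition basic_ball :: "'a set \<Rightarrow> ('a \<Rightarrow> 'a \<Rightarrow> real) \<Rightarrow> (nat \<Rightarrow> 'a) \<Rightarrow> nat \<Rightarrow> 'a set" where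
  "basic_ball M d \<alpha> m =
     (case prod_decode m of (n, k) \<Rightarrow> Metric_space.mball M d (\<alpha> n) (rat_enum k))"

definition rep_closed_neg :: "'a set \<Rightarrow> ('a \<Rightarrow> 'a \<Rightarrow> real) \<Rightarrow> (nat \<Rightarrow> 'a) \<Rightarrow> 'a set rep" where
  "rep_closed_neg M d \<alpha> p = Some (M - (\<Union>i. basic_ball M d \<alpha> (p i)))"

text \<open>
  Since \<open>\<infinity>\<close> is isolated, the part inside \<open>M\<close> of the closure of a set of points of the extended
  space is the closure in \<open>M\<close> of those of its points that lie in \<open>M\<close>.
\<close>

definition rep_closed_pos :: "'a set \<Rightarrow> ('a \<Rightarrow> 'a \<Rightarrow> real) \<Rightarrow> (nat \<Rightarrow> 'a) \<Rightarrow> 'a set rep" where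
  "rep_closed_pos M d \<alpha> p =
     map_option (\<lambda>x. Metric_space.mtopology M d closure_of {y. Some y \<in> range x})
       (rep_seq (rep_inf M d \<alpha>) p)"

definition BCT_vals :: "'a set \<Rightarrow> ('a \<Rightarrow> 'a \<Rightarrow> real) \<Rightarrow> (nat \<Rightarrow> 'a set) \<Rightarrow> 'a set" where
  "BCT_vals M d A =
     (if \<forall>i. closedin (Metric_space.mtopology M d) (A i) \<and>
             Metric_space.mtopology M d interior_of (A i) = {}
      then M - (\<Union>i. A i) else {})"

text \<open>
  By the Baire category theorem, the domain (the set of points with a nonempty set of values)
  is the intended one.
\<close>

lemma (in computable_polish_space) BCT_dom:
  "BCT_vals M d A \<noteq> {} \<longleftrightarrow>
     (\<forall>i. closedin mtopology (A i) \<and> mtopology interior_of (A i) = {})"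
proof -
  have "M \<noteq> {}"
    using dense_in by auto
  moreover have "mtopology interior_of (\<Union>i. A i) = {}"
    if "\<forall>i. closedin mtopology (A i) \<and> mtopology interior_of (A i) = {}"
    using that by (intro metric_Baire_category_alt) (auto simp: complete)
  moreover have "mtopology interior_of M = M"
    using interior_of_topspace[of mtopology] by simp
  ultimately have "M - (\<Union>i. A i) \<noteq> {}"
    if "\<forall>i. closedin mtopology (A i) \<and> mtopology interior_of (A i) = {}"
    using that interior_of_mono[of M "\<Union>i. A i" mtopology] by auto
  then show ?thesis
    by (auto simp: BCT_vals_def)
qed

definition BCT0 ::
  "'a set \<Rightarrow> ('a \<Rightarrow> 'a \<Rightarrow> real) \<Rightarrow> (nat \<Rightarrow> 'a) \<Rightarrow> (nat \<Rightarrow> 'a set, 'a) problem" where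
  "BCT0 M d \<alpha> =
     \<lparr> in_rep = rep_seq (rep_closed_neg M d \<alpha>),
       out_rep = cauchy_rep M d \<alpha>,
       vals = BCT_vals M d \<rparr>"

definition BCT2 ::
  "'a set \<Rightarrow> ('a \<Rightarrow> 'a \<Rightarrow> real) \<Rightarrow> (nat \<Rightarrow> 'a) \<Rightarrow> (nat \<Rightarrow> 'a set, 'a) problem" where
  "BCT2 M d \<alpha> =
     \<lparr> in_rep = rep_seq (rep_closed_pos M d \<alpha>),
       out_rep = cauchy_rep M d \<alpha>,
       vals = BCT_vals M d \<rparr>"

end

theory Submission
  imports Defs
begin

text \<open>
  All instances that the parallelization of a Baire category problem receives concern the same
  space.  Countably many sequences of nowhere dense closed sets can be merged into one such
  sequence, and by the Baire category theorem there is a point outside all of these sets.  This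
  single point answers every instance, so one call of the original problem suffices, and the
  answer is returned infinitely often.  Merging needs only a renumbering of the indices of the
  sets, so it works for any representation of closed sets and treats negative and positive
  information alike.

  The translations of names are all of the form \<open>p \<mapsto> p \<circ> \<sigma>\<close> for a recursive function
  \<open>\<sigma>\<close> on the natural numbers.  Since limits in Baire space are taken coordinatewise, such a
  renumbering can be applied before the limit instead of after it
  (\<open>recursively_mergeable_lim\<close>).  By induction the merging is available for the names used by
  each jump, while jumps change neither the output names nor the values; this gives
  strong parallelizability (\<open>strongly_parallelizable_if_mergeable\<close>).  Strong idempotency is a
  general consequence, because a pair of instances can be expanded to the alternating sequence:
  \<open>f \<times> f\<close> reduces to the parallelization of \<open>f\<close>
  (\<open>prod_sW_le_parallelization\<close>).
\<close>

section \<open>Composition of computable functions\<close>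

text \<open>An oracle query is replaced by a program that answers it from another oracle.\<close>

fun subst_oracle :: "recfn \<Rightarrow> recfn \<Rightarrow> recfn" where
  "subst_oracle e Oracle = Comp e [Proj 0]"
| "subst_oracle e (Comp f gs) = Comp (subst_oracle e f) (map (subst_oracle e) gs)"
| "subst_oracle e (Prec f g) = Prec (subst_oracle e f) (subst_oracle e g)"
| "subst_oracle e (Mini f) = Mini (subst_oracle e f)"
| "subst_oracle e c = c"

lemma run_subst_oracle:
  assumes "\<And>n. run p e [n] = Some (q n)"
  shows "run p (subst_oracle e c) xs = run q c xs"
proof (induction c arbitrary: xs)
  case (Comp f gs)
  have "map (\<lambda>g. run p g xs) (map (subst_oracle e) gs) = map (\<lambda>g. run q g xs) gs"
    using Comp.IH(2) by simp
  then show ?case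
    using Comp.IH(1) by (simp only: subst_oracle.simps run.simps)
qed (auto simp: assms split: list.split)

lemma computable_map_comp:
  assumes "computable F" "computable G"
  shows "computable (G \<circ>\<^sub>m F)"
proof -
  obtain e where e: "\<And>p q n. F p = Some q \<Longrightarrow> run p e [n] = Some (q n)"
    using assms(1) unfolding computable_def by blast
  obtain c where c: "\<And>p q n. G p = Some q \<Longrightarrow> run p c [n] = Some (q n)"
    using assms(2) unfolding computable_def by blast
  have "run p (subst_oracle e c) [n] = Some (r n)" if r: "(G \<circ>\<^sub>m F) p = Some r" for p r n
  proof -
    obtain q where "F p = Some q" "G q = Some r"
      using r by (auto simp: map_comp_Some_iff)
    then show ?thesis
      using run_subst_oracle[of p e q c "[n]"] e c by simp
  qed
  then show ?thesis
    unfolding computable_def by blast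
qed

lemma map_comp_assoc: "F \<circ>\<^sub>m (G \<circ>\<^sub>m H) = F \<circ>\<^sub>m G \<circ>\<^sub>m H"
  by (auto simp: map_comp_def split: option.split)

lemma sW_le_trans:
  assumes "f \<le>sW g" "g \<le>sW h"
  shows "f \<le>sW h"
proof -
  obtain K H where KH: "computable K" "computable H"
      "\<And>G. G \<turnstile>r g \<Longrightarrow> (H \<circ>\<^sub>m G \<circ>\<^sub>m K) \<turnstile>r f"
    using assms(1) unfolding sW_le_def by blast
  obtain K' H' where KH': "computable K'" "computable H'"
      "\<And>G. G \<turnstile>r h \<Longrightarrow> (H' \<circ>\<^sub>m G \<circ>\<^sub>m K') \<turnstile>r g"
    using assms(2) unfolding sW_le_def by blast
  have "((H \<circ>\<^sub>m H') \<circ>\<^sub>m G \<circ>\<^sub>m (K' \<circ>\<^sub>m K)) \<turnstile>r f" if "G \<turnstile>r h" for G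
    using KH(3)[OF KH'(3)[OF that]] by (simp add: map_comp_assoc)
  then show ?thesis
    unfolding sW_le_def
    by (intro exI[of _ "K' \<circ>\<^sub>m K"] exI[of _ "H \<circ>\<^sub>m H'"] conjI allI impI
        computable_map_comp KH(1,2) KH'(1,2))
qed

section \<open>Recursive functions and renumbering of coordinates\<close>

definition total_recursive :: "(nat \<Rightarrow> nat) \<Rightarrow> bool" where
  "total_recursive \<sigma> \<longleftrightarrow> (\<exists>c. \<forall>p n. run p c [n] = Some (\<sigma> n))"

lemma total_recursiveI: "(\<And>p n. run p c [n] = Some (\<sigma> n)) \<Longrightarrow> total_recursive \<sigma>"
  unfolding total_recursive_def by blast

lemma total_recursive_id: "total_recursive (\<lambda>n. n)"
  by (rule total_recursiveI[of "Proj 0"]) simp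

lemma total_recursive_zero: "total_recursive (\<lambda>n. 0)"
  by (rule total_recursiveI[of Zero]) simp

lemma total_recursive_comp1:
  assumes "\<And>p x. run p c [x] = Some (h x)" and "total_recursive \<sigma>"
  shows "total_recursive (\<lambda>n. h (\<sigma> n))"
proof -
  obtain a where "\<And>p n. run p a [n] = Some (\<sigma> n)"
    using assms(2) unfolding total_recursive_def by blast
  then show ?thesis
    by (intro total_recursiveI[of "Comp c [a]"]) (simp add: assms(1))
qed

lemma total_recursive_comp2:
  assumes "\<And>p x y. run p c [x, y] = Some (h x y)"
    and "total_recursive \<sigma>" "total_recursive \<tau>"
  shows "total_recursive (\<lambda>n. h (\<sigma> n) (\<tau> n))"
proof -
  obtain a b where "\<And>p n. run p a [n] = Some (\<sigma> n)" "\<And>p n. run p b [n] = Some (\<tau> n)"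
    using assms(2,3) unfolding total_recursive_def by blast
  then show ?thesis
    by (intro total_recursiveI[of "Comp c [a, b]"]) (simp add: assms(1))
qed

definition rf_add :: recfn where
  "rf_add = Prec (Proj 0) (Comp Succ [Proj 0])"

definition rf_pred :: recfn where
  "rf_pred = Prec Zero (Proj 1)"

text \<open>
  The subtrahend is the first argument, since primitive recursion runs over the first argument.
\<close>

definition rf_monus :: recfn where
  "rf_monus = Prec (Proj 0) (Comp rf_pred [Proj 0])"

definition rf_triangle :: recfn where
  "rf_triangle = Prec Zero (Comp rf_add [Proj 0, Comp Succ [Proj 1]])"

text \<open>Parity is iterated through \<open>r \<mapsto> 1 - r\<close>; halving adds up the parities of all smaller numbers.\<close>

definition rf_mod2 :: recfn where
  "rf_mod2 = Prec Zero (Comp rf_monus [Proj 0, Comp Succ [Zero]])"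

definition rf_div2 :: recfn where
  "rf_div2 = Prec Zero (Comp rf_add [Proj 0, Comp rf_mod2 [Proj 1]])"

definition rf_encode :: recfn where
  "rf_encode = Comp rf_add [Comp rf_triangle [rf_add], Proj 0]"

text \<open>
  The code of \<open>(i, j)\<close> is \<open>triangle (i + j) + i\<close>, hence \<open>i + j\<close> is the least \<open>r\<close> for
  which \<open>triangle (Suc r)\<close> exceeds the code.
\<close>

definition rf_decode_sum :: recfn where
  "rf_decode_sum = Mini (Comp rf_monus [Comp rf_triangle [Comp Succ [Proj 0]], Comp Succ [Proj 1]])"

definition rf_fst :: recfn where
  "rf_fst = Comp rf_monus [Comp rf_triangle [rf_decode_sum], Proj 0]"

definition rf_snd :: recfn where
  "rf_snd = Comp rf_monus [rf_fst, rf_decode_sum]"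

lemma run_rf_add: "run p rf_add [m, n] = Some (m + n)"
  unfolding rf_add_def by (induction m) auto

lemma run_rf_pred: "run p rf_pred [m] = Some (m - 1)"
  unfolding rf_pred_def by (induction m) auto

lemma run_rf_monus: "run p rf_monus [m, n] = Some (n - m)"
  unfolding rf_monus_def by (induction m) (auto simp: run_rf_pred)

lemma run_rf_triangle: "run p rf_triangle [m] = Some (triangle m)"
  unfolding rf_triangle_def by (induction m) (auto simp: run_rf_add)

lemma run_rf_mod2: "run p rf_mod2 [m] = Some (m mod 2)"
  unfolding rf_mod2_def by (induction m) (auto simp: run_rf_monus mod_Suc)

lemma run_rf_div2: "run p rf_div2 [m] = Some (m div 2)"
  unfolding rf_div2_def by (induction m) (auto simp: run_rf_add run_rf_mod2 div_Suc mod_Suc)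

lemma run_rf_encode: "run p rf_encode [i, j] = Some (prod_encode (i, j))"
  unfolding rf_encode_def by (simp add: run_rf_add run_rf_triangle prod_encode_def)

lemma triangle_mono: "m \<le> n \<Longrightarrow> triangle m \<le> triangle n"
  unfolding triangle_def by (intro div_le_mono mult_le_mono) auto

lemma run_rf_decode_sum: "run p rf_decode_sum [prod_encode (i, j)] = Some (i + j)"
proof -
  let ?n = "prod_encode (i, j)"
  let ?f = "Comp rf_monus [Comp rf_triangle [Comp Succ [Proj 0]], Comp Succ [Proj 1]]"
  have f: "run p ?f [r, ?n] = Some (Suc ?n - triangle (Suc r))" for r
    by (simp add: run_rf_monus run_rf_triangle del: triangle_Suc)
  have zero: "Suc ?n - triangle (Suc r) = 0 \<longleftrightarrow> i + j \<le> r" for r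
  proof (cases "i + j \<le> r")
    case True
    then have "triangle (Suc (i + j)) \<le> triangle (Suc r)"
      by (intro triangle_mono) simp
    with True show ?thesis
      by (simp add: prod_encode_def)
  next
    case False
    then have "triangle (Suc r) \<le> triangle (i + j)"
      by (intro triangle_mono) simp
    with False show ?thesis
      by (simp add: prod_encode_def del: triangle_Suc)
  qed
  have "(LEAST r. i + j \<le> r) = i + j"
    by (rule Least_equality) auto
  then show ?thesis
    unfolding rf_decode_sum_def run.simps(7) f option.inject zero by auto
qed

lemma run_rf_fst: "run p rf_fst [n] = Some (fst (prod_decode n))"
proof -
  obtain i j where "n = prod_encode (i, j)"
    by (metis prod_decode_inverse surj_pair)
  then show ?thesis
    unfolding rf_fst_def
    by (simp add: run_rf_decode_sum run_rf_triangle run_rf_monus) (simp add: prod_encode_def)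
qed

lemma run_rf_snd: "run p rf_snd [n] = Some (snd (prod_decode n))"
proof -
  obtain i j where "n = prod_encode (i, j)"
    by (metis prod_decode_inverse surj_pair)
  then show ?thesis
    unfolding rf_snd_def by (simp add: run_rf_decode_sum run_rf_fst run_rf_monus)
qed

lemmas total_recursive_intros =
  total_recursive_id total_recursive_zero
  total_recursive_comp2[OF run_rf_add]
  total_recursive_comp1[OF run_rf_div2]
  total_recursive_comp1[OF run_rf_mod2]
  total_recursive_comp2[OF run_rf_encode]
  total_recursive_comp1[OF run_rf_fst]
  total_recursive_comp1[OF run_rf_snd]

lemma total_recursive_compose:
  assumes "total_recursive \<sigma>" "total_recursive \<tau>"
  shows "total_recursive (\<lambda>n. \<sigma> (\<tau> n))"
proof -
  obtain c where "\<And>p n. run p c [n] = Some (\<sigma> n)"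
    using assms(1) unfolding total_recursive_def by blast
  then show ?thesis
    using total_recursive_comp1 assms(2) by blast
qed

lemma computable_renumber:
  assumes "total_recursive \<sigma>"
  shows "computable (\<lambda>p. Some (\<lambda>n. p (\<sigma> n)))"
proof -
  obtain c where "\<And>p n. run p c [n] = Some (\<sigma> n)"
    using assms unfolding total_recursive_def by blast
  then have "run p (Comp Oracle [c]) [n] = Some (p (\<sigma> n))" for p n
    by simp
  then show ?thesis
    unfolding computable_def by (intro exI[of _ "Comp Oracle [c]"]) auto
qed

text \<open>
  A realizer of \<open>g\<close> may return any name of any solution, so quantifying over all such names
  removes realizers from the proof of a reduction.
\<close>

lemma sW_le_if_renumbering:
  assumes "total_recursive \<sigma>" "total_recursive \<tau>"
    and red: "\<And>p x. in_rep f p = Some x \<Longrightarrow> vals f x \<noteq> {} \<Longrightarrow>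
      \<exists>z. in_rep g (\<lambda>n. p (\<sigma> n)) = Some z \<and> vals g z \<noteq> {} \<and>
        (\<forall>q y. out_rep g q = Some y \<longrightarrow> y \<in> vals g z \<longrightarrow>
           (\<exists>w. out_rep f (\<lambda>n. q (\<tau> n)) = Some w \<and> w \<in> vals f x))"
  shows "f \<le>sW g"
proof -
  let ?K = "\<lambda>p. Some (\<lambda>n. p (\<sigma> n)) :: baire option"
  let ?H = "\<lambda>q. Some (\<lambda>n. q (\<tau> n)) :: baire option"
  have "(?H \<circ>\<^sub>m G \<circ>\<^sub>m ?K) \<turnstile>r f" if G: "G \<turnstile>r g" for G
    unfolding realizes_def
  proof (intro allI impI, elim conjE)
    fix p x assume "in_rep f p = Some x" "vals f x \<noteq> {}"
    from red[OF this] obtain z where z: "in_rep g (\<lambda>n. p (\<sigma> n)) = Some z" "vals g z \<noteq> {}"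
      and out: "\<And>q y. out_rep g q = Some y \<Longrightarrow> y \<in> vals g z \<Longrightarrow>
        \<exists>w. out_rep f (\<lambda>n. q (\<tau> n)) = Some w \<and> w \<in> vals f x"
      by blast
    obtain y where y: "(out_rep g \<circ>\<^sub>m G) (\<lambda>n. p (\<sigma> n)) = Some y" "y \<in> vals g z"
      using G z unfolding realizes_def by blast
    then obtain q where "G (\<lambda>n. p (\<sigma> n)) = Some q" "out_rep g q = Some y"
      by (auto simp: map_comp_Some_iff)
    then show "\<exists>w. (out_rep f \<circ>\<^sub>m (?H \<circ>\<^sub>m G \<circ>\<^sub>m ?K)) p = Some w \<and> w \<in> vals f x"
      using out y(2) by (simp add: map_comp_def)
  qed
  then show ?thesis
    unfolding sW_le_def
    by (intro exI[of _ ?K] exI[of _ ?H] conjI allI impI computable_renumber assms(1,2))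
qed

section \<open>Parallelization and products\<close>

lemma rep_seq_eq_Some: "rep_seq \<delta> p = Some x \<longleftrightarrow> (\<forall>i. \<delta> (row p i) = Some (x i))"
proof
  assume "rep_seq \<delta> p = Some x"
  then show "\<forall>i. \<delta> (row p i) = Some (x i)"
    by (fastforce simp: rep_seq_def split: if_splits)
qed (simp add: rep_seq_def)

lemma rep_prod_eq_Some:
  "rep_prod \<delta> \<epsilon> p = Some z \<longleftrightarrow>
     \<delta> (\<lambda>n. p (2 * n)) = Some (fst z) \<and> \<epsilon> (\<lambda>n. p (2 * n + 1)) = Some (snd z)"
  by (cases z) (auto simp: rep_prod_def split: option.split)

lemma sW_le_parallelization: "f \<le>sW parallelization f"
proof (rule sW_le_if_renumbering)
  show "total_recursive (\<lambda>n. snd (prod_decode n))" "total_recursive (\<lambda>n. prod_encode (0, n))"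
    by (intro total_recursive_intros)+
next
  fix p x assume "in_rep f p = Some x" "vals f x \<noteq> {}"
  then show "\<exists>z. in_rep (parallelization f) (\<lambda>n. p (snd (prod_decode n))) = Some z \<and>
      vals (parallelization f) z \<noteq> {} \<and>
      (\<forall>q y. out_rep (parallelization f) q = Some y \<longrightarrow> y \<in> vals (parallelization f) z \<longrightarrow>
        (\<exists>w. out_rep f (\<lambda>n. q (prod_encode (0, n))) = Some w \<and> w \<in> vals f x))"
    by (intro exI[of _ "\<lambda>_. x"]) (auto simp: parallelization_def rep_seq_eq_Some row_def)
qed

lemma sW_le_prod_self: "f \<le>sW prod_problem f f"
proof (rule sW_le_if_renumbering)
  show "total_recursive (\<lambda>n. n div 2)" "total_recursive (\<lambda>n. n + n)"
    by (intro total_recursive_intros)+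
next
  fix p x assume "in_rep f p = Some x" "vals f x \<noteq> {}"
  then show "\<exists>z. in_rep (prod_problem f f) (\<lambda>n. p (n div 2)) = Some z \<and>
      vals (prod_problem f f) z \<noteq> {} \<and>
      (\<forall>q y. out_rep (prod_problem f f) q = Some y \<longrightarrow> y \<in> vals (prod_problem f f) z \<longrightarrow>
        (\<exists>w. out_rep f (\<lambda>n. q (n + n)) = Some w \<and> w \<in> vals f x))"
    by (intro exI[of _ "(x, x)"]) (auto simp: prod_problem_def rep_prod_eq_Some mult_2)
qed

text \<open>
  The pair \<open>(x, y)\<close> is expanded to the sequence \<open>x, y, x, y, \<dots>\<close>, whose entries at \<open>0\<close>
  and \<open>1\<close> are then read off.
\<close>

lemma prod_sW_le_parallelization: "prod_problem f f \<le>sW parallelization f"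
proof -
  let ?\<sigma> = "\<lambda>n. (snd (prod_decode n) + snd (prod_decode n)) + fst (prod_decode n) mod 2"
  let ?\<tau> = "\<lambda>n. prod_encode (n mod 2, n div 2)"
  have \<sigma>: "total_recursive ?\<sigma>" and \<tau>: "total_recursive ?\<tau>"
    by (intro total_recursive_intros)+
  show ?thesis
  proof (rule sW_le_if_renumbering[OF \<sigma> \<tau>])
    fix p x assume in_x: "in_rep (prod_problem f f) p = Some x"
      and ne: "vals (prod_problem f f) x \<noteq> {}"
    let ?z = "\<lambda>i::nat. if even i then fst x else snd x"
    have 1: "in_rep (parallelization f) (\<lambda>n. p (?\<sigma> n)) = Some ?z"
    proof -
      have "in_rep f (\<lambda>n. p (n + n)) = Some (fst x)" "in_rep f (\<lambda>n. p (n + n + 1)) = Some (snd x)"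
        using in_x by (simp_all add: prod_problem_def rep_prod_eq_Some mult_2)
      then have "in_rep f (\<lambda>n. p (n + n + i mod 2)) = Some (?z i)" for i
        by (cases "even i") (simp_all add: mod2_eq_if)
      then show ?thesis
        by (simp add: parallelization_def rep_seq_eq_Some row_def)
    qed
    have vals_ne: "vals f (fst x) \<noteq> {}" "vals f (snd x) \<noteq> {}"
      using ne by (auto simp: prod_problem_def split: prod.splits)
    have 2: "vals (parallelization f) ?z \<noteq> {}"
    proof -
      obtain a b where "a \<in> vals f (fst x)" "b \<in> vals f (snd x)"
        using vals_ne by blast
      then have "(\<lambda>i. if even i then a else b) \<in> vals (parallelization f) ?z"
        by (simp add: parallelization_def)
      then show ?thesis by blast
    qed
    have 3: "\<exists>w. out_rep (prod_problem f f) (\<lambda>n. q (?\<tau> n)) = Some w \<and> w \<in> vals (prod_problem f f) x"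
      if q: "out_rep (parallelization f) q = Some y" and y: "y \<in> vals (parallelization f) ?z" for q y
    proof (intro exI conjI)
      have rows: "out_rep f (row q 0) = Some (y 0)" "out_rep f (row q 1) = Some (y 1)"
        using q by (auto simp: parallelization_def rep_seq_eq_Some)
      then show "out_rep (prod_problem f f) (\<lambda>n. q (?\<tau> n)) = Some (y 0, y 1)"
        by (simp add: prod_problem_def rep_prod_eq_Some row_def)
      have "y i \<in> vals f (?z i)" for i
        using y by (simp add: parallelization_def)
      from this[of 0] this[of 1] show "(y 0, y 1) \<in> vals (prod_problem f f) x"
        by (auto simp: prod_problem_def split: prod.splits)
    qed
    show "\<exists>z. in_rep (parallelization f) (\<lambda>n. p (?\<sigma> n)) = Some z \<and>
        vals (parallelization f) z \<noteq> {} \<and>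
        (\<forall>q y. out_rep (parallelization f) q = Some y \<longrightarrow> y \<in> vals (parallelization f) z \<longrightarrow>
          (\<exists>w. out_rep (prod_problem f f) (\<lambda>n. q (?\<tau> n)) = Some w \<and>
            w \<in> vals (prod_problem f f) x))"
      by (rule exI[of _ ?z]) (intro conjI 1 2 allI impI 3)
  qed
qed

lemma strongly_idempotent_if_strongly_parallelizable:
  assumes "strongly_parallelizable f"
  shows "strongly_idempotent f"
proof -
  have "parallelization f \<le>sW f"
    using assms by (simp add: strongly_parallelizable_def sW_equiv_def)
  then have "prod_problem f f \<le>sW f"
    by (rule sW_le_trans[OF prod_sW_le_parallelization])
  then show ?thesis
    by (simp add: strongly_idempotent_def sW_equiv_def sW_le_prod_self)
qed

section \<open>Merging a sequence of inputs\<close>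

text \<open>
  The combined input \<open>m x\<close> must have a name that is a mere renumbering of the name of the
  sequence \<open>x\<close>.  Arbitrary computable translations of names would not do, since they need
  not commute with the limit in the definition of the jump.
\<close>

definition recursively_mergeable :: "((nat \<Rightarrow> 'a) \<Rightarrow> 'a) \<Rightarrow> 'a rep \<Rightarrow> bool" where
  "recursively_mergeable m \<delta> \<longleftrightarrow>
     (\<exists>\<sigma>. total_recursive \<sigma> \<and>
        (\<forall>p x. rep_seq \<delta> p = Some x \<longrightarrow> \<delta> (\<lambda>n. p (\<sigma> n)) = Some (m x)))"

text \<open>
  A name of a sequence for \<open>\<delta> \<circ>\<^sub>m baire_lim\<close> holds, at \<open>\<langle>i, \<langle>n, k\<rangle>\<rangle>\<close>, the
  \<open>n\<close>-th approximation to the \<open>k\<close>-th value of the \<open>i\<close>-th \<open>\<delta>\<close>-name.  If \<open>\<sigma>\<close>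
  fetches the \<open>j\<close>-th value of the merged name from \<open>\<langle>i, k\<rangle>\<close>, then its \<open>n\<close>-th
  approximation is fetched from \<open>\<langle>i, \<langle>n, k\<rangle>\<rangle>\<close>.
\<close>

lemma recursively_mergeable_lim:
  assumes "recursively_mergeable m \<delta>"
  shows "recursively_mergeable m (\<delta> \<circ>\<^sub>m baire_lim)"
proof -
  obtain \<sigma> where \<sigma>: "total_recursive \<sigma>"
    and merge: "\<And>p x. rep_seq \<delta> p = Some x \<Longrightarrow> \<delta> (\<lambda>n. p (\<sigma> n)) = Some (m x)"
    using assms unfolding recursively_mergeable_def by blast
  let ?c = "\<lambda>l. prod_decode (\<sigma> (snd (prod_decode l)))"
  let ?\<sigma>' = "\<lambda>l. prod_encode (fst (?c l), prod_encode (fst (prod_decode l), snd (?c l)))"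
  have "total_recursive ?\<sigma>'"
    by (intro total_recursive_intros total_recursive_compose[OF \<sigma>])
  moreover have "(\<delta> \<circ>\<^sub>m baire_lim) (\<lambda>l. p (?\<sigma>' l)) = Some (m x)"
    if p: "rep_seq (\<delta> \<circ>\<^sub>m baire_lim) p = Some x" for p x
  proof -
    have "\<exists>q. baire_lim (row p i) = Some q \<and> \<delta> q = Some (x i)" for i
      using p by (auto simp: rep_seq_eq_Some map_comp_Some_iff)
    then obtain q where lim: "\<And>i. baire_lim (row p i) = Some (q i)"
      and q: "\<And>i. \<delta> (q i) = Some (x i)"
      by metis
    let ?q = "\<lambda>l. q (fst (prod_decode l)) (snd (prod_decode l))"
    have "rep_seq \<delta> ?q = Some x"
      using q by (simp add: rep_seq_eq_Some row_def)
    moreover have "baire_lim (\<lambda>l. p (?\<sigma>' l)) = Some (\<lambda>j. ?q (\<sigma> j))"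
      using lim by (simp add: baire_lim_eq row_def)
    ultimately show ?thesis
      using merge by (simp add: map_comp_Some_iff)
  qed
  ultimately show ?thesis
    unfolding recursively_mergeable_def by blast
qed

lemma recursively_mergeable_rep_seq:
  "recursively_mergeable (\<lambda>x l. x (fst (prod_decode l)) (snd (prod_decode l))) (rep_seq \<delta>)"
proof -
  \<comment> \<open>The entry of the merged sequence at \<open>l = \<langle>k, i\<rangle>\<close> has its \<open>j\<close>-th value at \<open>\<langle>k, \<langle>i, j\<rangle>\<rangle>\<close>.\<close>
  let ?l = "\<lambda>n. prod_decode (fst (prod_decode n))"
  let ?\<sigma> = "\<lambda>n. prod_encode (fst (?l n), prod_encode (snd (?l n), snd (prod_decode n)))"
  have "total_recursive ?\<sigma>"
    by (intro total_recursive_intros)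
  moreover have "rep_seq \<delta> (\<lambda>n. p (?\<sigma> n)) =
      Some (\<lambda>l. x (fst (prod_decode l)) (snd (prod_decode l)))"
    if "rep_seq (rep_seq \<delta>) p = Some x" for p and x :: "nat \<Rightarrow> nat \<Rightarrow> 'a"
    using that by (simp add: rep_seq_eq_Some row_def)
  ultimately show ?thesis
    unfolding recursively_mergeable_def by blast
qed

text \<open>One solution of the merged input is repeated to solve all entries of the sequence.\<close>

lemma strongly_parallelizable_if_mergeable:
  assumes "recursively_mergeable m (in_rep f)"
    and ne: "\<And>x. (\<And>i. vals f (x i) \<noteq> {}) \<Longrightarrow> vals f (m x) \<noteq> {}"
    and sub: "\<And>x i. (\<And>i. vals f (x i) \<noteq> {}) \<Longrightarrow> vals f (m x) \<subseteq> vals f (x i)"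
  shows "strongly_parallelizable f"
proof -
  obtain \<sigma> where \<sigma>: "total_recursive \<sigma>"
    and merge: "\<And>p x. rep_seq (in_rep f) p = Some x \<Longrightarrow> in_rep f (\<lambda>n. p (\<sigma> n)) = Some (m x)"
    using assms(1) unfolding recursively_mergeable_def by blast
  have "parallelization f \<le>sW f"
  proof (rule sW_le_if_renumbering[OF \<sigma>])
    show "total_recursive (\<lambda>n. snd (prod_decode n))"
      by (intro total_recursive_intros)
  next
    fix p x assume p: "in_rep (parallelization f) p = Some x"
      and "vals (parallelization f) x \<noteq> {}"
    then have vals_ne: "vals f (x i) \<noteq> {}" for i
      by (auto simp: parallelization_def)
    have "out_rep (parallelization f) (\<lambda>n. q (snd (prod_decode n))) = Some (\<lambda>_. y) \<and>
        (\<lambda>_. y) \<in> vals (parallelization f) x"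
      if "out_rep f q = Some y" "y \<in> vals f (m x)" for q y
      using that sub[of x, OF vals_ne] by (auto simp: parallelization_def rep_seq_eq_Some row_def)
    then show "\<exists>z. in_rep f (\<lambda>n. p (\<sigma> n)) = Some z \<and> vals f z \<noteq> {} \<and>
        (\<forall>q y. out_rep f q = Some y \<longrightarrow> y \<in> vals f z \<longrightarrow>
          (\<exists>w. out_rep (parallelization f) (\<lambda>n. q (snd (prod_decode n))) = Some w \<and>
            w \<in> vals (parallelization f) x))"
      using merge[of p x] p ne[of x, OF vals_ne] by (auto simp: parallelization_def)
  qed
  then show ?thesis
    using sW_le_parallelization unfolding strongly_parallelizable_def sW_equiv_def by blast
qed

section \<open>Jumps of the Baire category problems\<close>

lemma vals_jump_iter: "vals ((jump ^^ n) f) = vals f"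
  by (induction n) (simp_all add: jump_def)

lemma recursively_mergeable_jump_iter:
  "recursively_mergeable m (in_rep f) \<Longrightarrow> recursively_mergeable m (in_rep ((jump ^^ n) f))"
  by (induction n) (simp_all add: jump_def recursively_mergeable_lim)

text \<open>
  The inclusion is immediate; that the merged instance is again solvable is the Baire category
  theorem.
\<close>

lemma (in computable_polish_space) BCT_vals_merge:
  fixes A :: "nat \<Rightarrow> nat \<Rightarrow> 'a set"
  assumes "\<And>k. BCT_vals M d (A k) \<noteq> {}"
  defines "B \<equiv> \<lambda>l. A (fst (prod_decode l)) (snd (prod_decode l))"
  shows "BCT_vals M d B \<noteq> {}" and "BCT_vals M d B \<subseteq> BCT_vals M d (A k)"
proof -
  have nd: "closedin mtopology (A k i) \<and> mtopology interior_of (A k i) = {}" for k i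
    using assms(1) by (simp add: BCT_dom)
  then show "BCT_vals M d B \<noteq> {}"
    by (simp add: BCT_dom B_def)
  have "A k i = B (prod_encode (k, i))" for i
    by (simp add: B_def)
  then show "BCT_vals M d B \<subseteq> BCT_vals M d (A k)"
    using nd by (auto simp: BCT_vals_def)
qed

text \<open>
  The type of \<open>vals\<close> leaves the representation \<open>\<delta>\<close> of closed sets open, so the argument
  covers negative and positive information at once.
\<close>

lemma (in computable_polish_space) strongly_parallelizable_jump_BCT:
  assumes "in_rep f = rep_seq \<delta>" and "vals f = BCT_vals M d"
  shows "strongly_parallelizable ((jump ^^ n) f)"
proof (rule strongly_parallelizable_if_mergeable)
  let ?m = "\<lambda>(x :: nat \<Rightarrow> nat \<Rightarrow> 'a set) l. x (fst (prod_decode l)) (snd (prod_decode l))"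
  show "recursively_mergeable ?m (in_rep ((jump ^^ n) f))"
    by (intro recursively_mergeable_jump_iter)
      (simp only: assms(1) recursively_mergeable_rep_seq)
qed (use BCT_vals_merge in \<open>auto simp: vals_jump_iter assms(2)\<close>)

theorem proposition5p5:
  fixes M :: "'a set" and d :: "'a \<Rightarrow> 'a \<Rightarrow> real" and \<alpha> :: "nat \<Rightarrow> 'a" and n :: nat
  assumes "computable_polish_space M d \<alpha>"
  shows "strongly_parallelizable ((jump ^^ n) (BCT0 M d \<alpha>)) \<and>
         strongly_idempotent ((jump ^^ n) (BCT0 M d \<alpha>)) \<and>
         strongly_parallelizable ((jump ^^ n) (BCT2 M d \<alpha>)) \<and>
         strongly_idempotent ((jump ^^ n) (BCT2 M d \<alpha>))"
proof -
  interpret computable_polish_space M d \<alpha> by (fact assms)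
  have "strongly_parallelizable ((jump ^^ n) (BCT0 M d \<alpha>))"
    by (rule strongly_parallelizable_jump_BCT) (simp_all add: BCT0_def)
  moreover have "strongly_parallelizable ((jump ^^ n) (BCT2 M d \<alpha>))"
    by (rule strongly_parallelizable_jump_BCT) (simp_all add: BCT2_def)
  ultimately show ?thesis
    by (simp add: strongly_idempotent_if_strongly_parallelizable)
qed

end
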